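(* Let $A\in\mathbb{R}^{m\times n}$ and $1\le k\le\min\{m,n\}$, and let $V\in\mathbb{R}^{m\times k}$ and $W\in\mathbb{R}^{n\times k}$ be the matrices (with orthonormal columns) of leading $k$ left and right singular vectors of $A$. Let $p=\mathrm{DEIM}(V)$ and $q=\mathrm{DEIM}(W)$ be index vectors produced by the DEIM selection scheme, and let $P=I_m(:,p)$, $Q=I_n(:,q)$, $\eta_p=\|(P^TV)^{-1}\|$, $\eta_q=\|(W^TQ)^{-1}\|$. Then $$\eta_p<\sqrt{\frac{mk}{3}}\;2^k,\qquad \eta_q<\sqrt{\frac{nk}{3}}\;2^k.$$
   Context: $\|\cdot\|$ is the spectral norm. $I_m(:,p)=[e_{p_1},\dots,e_{p_k}]\in\mathbb{R}^{m\times k}$ is the matrix of columns of the identity indexed by $p$, so $P^TV=V(p,:)$ consists of the rows of $V$ indexed by $p$; similarly for $I_n(:,q)$. DEIM selection scheme: given a matrix $V=[v_1,\dots,v_k]\in\mathbb{R}^{m\times k}$ ($m\ge k$) with linearly independent columns, $\mathrm{DEIM}(V)=(p_1,\dots,p_k)$ is determined sequentially. The index $p_1$ is chosen with $|v_1(p_1)|=\|v_1\|_\infty$. For $j=2,\dots,k$, with $P_{j-1}=[e_{p_1},\dots,e_{p_{j-1}}]$ and $V_{j-1}=[v_1,\dots,v_{j-1}]$, set $r_j=v_j-V_{j-1}(P_{j-1}^TV_{j-1})^{-1}P_{j-1}^Tv_j$ and choose $p_j$ with $|r_j(p_j)|=\|r_j\|_\infty$. (Here $x(i)$ denotes the $i$th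 entry of a vector $x$; the matrices $P_{j-1}^TV_{j-1}$ are nonsingular, so the scheme is well defined.) $\mathrm{DEIM}(W)$ is obtained by the same procedure applied to $W$. *)

theory Defs
  imports Complex_Main "Jordan_Normal_Form.Gauss_Jordan_Elimination"
begin

text \<open>
  All indices are 0-based: the entries of a vector of dimension \<open>m\<close> are numbered
  \<open>0, ..., m - 1\<close>, and an index vector is a list of natural numbers.
\<close>

definition l2_norm_vec :: "real vec \<Rightarrow> real" where
  "l2_norm_vec x = sqrt (x \<bullet> x)"

definition linf_norm_vec :: "real vec \<Rightarrow> real" where
  "linf_norm_vec x = Max {\<bar>x $ i\<bar> | i. i < dim_vec x}"

text \<open>The matrix norm induced by the Euclidean vector norm.\<close>

definition spectral_norm :: "real mat \<Rightarrow> real" where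
  "spectral_norm A =
     Sup {l2_norm_vec (A *\<^sub>v x) | x. x \<in> carrier_vec (dim_col A) \<and> l2_norm_vec x \<le> 1}"

text \<open>Unspecified if \<open>A\<close> is not a nonsingular square matrix.\<close>

definition mat_inv :: "real mat \<Rightarrow> real mat" where
  "mat_inv A = the (mat_inverse A)"

text \<open>\<open>selection_mat m p\<close> is $I_m(:,p)$.\<close>

definition selection_mat :: "nat \<Rightarrow> nat list \<Rightarrow> real mat" where
  "selection_mat m p = mat_of_cols m (map (unit_vec m) p)"

definition first_cols :: "real mat \<Rightarrow> nat \<Rightarrow> real mat" where
  "first_cols V j = mat_of_cols (dim_row V) (take j (cols V))"

text \<open>
  \<open>deim_residual V p j\<close> is the residual from which the \<open>j\<close>-th index (0-based) is selected;
  of \<open>p\<close> it uses only the first \<open>j\<close> entries.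
\<close>

definition deim_residual :: "real mat \<Rightarrow> nat list \<Rightarrow> nat \<Rightarrow> real vec" where
  "deim_residual V p j =
     (if j = 0 then col V 0
      else let P = selection_mat (dim_row V) (take j p);
               Vj = first_cols V j
           in col V j - Vj *\<^sub>v (mat_inv (transpose_mat P * Vj) *\<^sub>v (transpose_mat P *\<^sub>v col V j)))"

text \<open>
  Ties in the maximisation may be broken arbitrarily, so the scheme is a relation:
  \<open>is_DEIM V p\<close> holds iff \<open>p\<close> is a possible outcome of the scheme applied to \<open>V\<close>.
\<close>

definition is_DEIM :: "real mat \<Rightarrow> nat list \<Rightarrow> bool" where
  "is_DEIM V p \<longleftrightarrow>
     length p = dim_col V \<and>
     (\<forall>j < dim_col V. p ! j < dim_row V \<and>
        \<bar>deim_residual V p j $ (p ! j)\<bar> = linf_norm_vec (deim_residual V p j))"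

text \<open>
  Full singular value decomposition $A = U S Y^T$ with \<open>U\<close> and \<open>Y\<close> square orthogonal and
  the singular values on the diagonal of the rectangular matrix \<open>S\<close> in nonincreasing order.
\<close>

definition is_svd :: "real mat \<Rightarrow> real mat \<Rightarrow> real mat \<Rightarrow> real mat \<Rightarrow> bool" where
  "is_svd A U S Y \<longleftrightarrow>
     (let m = dim_row A; n = dim_col A in
       U \<in> carrier_mat m m \<and> transpose_mat U * U = 1\<^sub>m m \<and>
       Y \<in> carrier_mat n n \<and> transpose_mat Y * Y = 1\<^sub>m n \<and>
       S \<in> carrier_mat m n \<and> diagonal_mat S \<and>
       (\<forall>i < min m n. 0 \<le> S $$ (i, i)) \<and>
       (\<forall>i j. i \<le> j \<longrightarrow> j < min m n \<longrightarrow> S $$ (j, j) \<le> S $$ (i, i)) \<and>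
       A = U * S * transpose_mat Y)"

text \<open>
  Singular vectors are not unique; \<open>V\<close> and \<open>W\<close> are required to come from one and the same
  singular value decomposition of \<open>A\<close>.
\<close>

definition leading_singular_vectors :: "real mat \<Rightarrow> nat \<Rightarrow> real mat \<Rightarrow> real mat \<Rightarrow> bool" where
  "leading_singular_vectors A k V W \<longleftrightarrow>
     (\<exists>U S Y. is_svd A U S Y \<and> V = first_cols U k \<and> W = first_cols Y k)"

end

theory Submission
  imports Defs "HOL-Analysis.Convex" "Jordan_Normal_Form.Determinant"
begin

text \<open>
  Because \<open>V\<close> has orthonormal columns, \<open>\<parallel>z\<parallel> = \<parallel>V z\<parallel>\<close>. Hence \<open>\<eta>\<^sub>p\<close> measures how large a vector
  \<open>u = V z\<close> of the column space can be when its entries \<open>x = P\<^sup>T u\<close> at the selected indices are given.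

  The greedy choice of the indices controls this. The residual \<open>r\<^sub>j\<close> vanishes at the indices selected
  before it, and it is nowhere larger in modulus than at the index \<open>p\<^sub>j\<close> selected from it. Write a
  vector \<open>u\<close> in the span of the first \<open>j + 1\<close> columns as \<open>w + c r\<^sub>j\<close> with \<open>w\<close> in the span of the first
  \<open>j\<close> columns. Then \<open>w\<close> and \<open>u\<close> agree at the earlier indices. If the entries of \<open>w\<close> are bounded by
  \<open>S\<close>, then \<open>\<bar>c r\<^sub>j\<bar> \<le> \<bar>u(p\<^sub>j)\<bar> + S\<close> everywhere, so the entries of \<open>u\<close> are bounded by
  \<open>2 S + \<bar>u(p\<^sub>j)\<bar>\<close>. By induction (lemmas \<open>greedy_step\<close>, \<open>DEIM_entry_bound\<close>),
  \<open>\<bar>u(i)\<bar> \<le> (\<Sum>l<k. 2^(k-1-l) \<bar>u(p\<^sub>l)\<bar>)\<close> for every \<open>i\<close>.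

  This bound also shows that an element of the span that vanishes at the selected indices is zero,
  so the interpolation matrices are nonsingular; the induction needs this at each stage to know
  that the next residual does interpolate.

  The Cauchy-Schwarz inequality and \<open>(\<Sum>l<k. 4^l) = (4^k - 1)/3\<close> turn the bound into
  \<open>\<parallel>u\<parallel>\<^sup>2 \<le> m (4^k - 1)/3 \<parallel>x\<parallel>\<^sup>2\<close>, that is \<open>\<eta>\<^sub>p \<le> sqrt (m (4^k - 1)/3)\<close>, which is below the claimed
  bound. For \<open>\<eta>\<^sub>q\<close> the same argument applies to \<open>Q\<^sup>T W\<close>, whose inverse is the transpose of
  the inverse of \<open>W\<^sup>T Q\<close>; a bound on the spectral norm passes to the transpose.
\<close>

section \<open>Euclidean and spectral norms\<close>

lemma scalar_prod_self_sum: "(x :: real vec) \<bullet> x = (\<Sum>i<dim_vec x. (x $ i)\<^sup>2)"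
  by (simp add: scalar_prod_def power2_eq_square atLeast0LessThan)

lemma l2_norm_vec_nonneg: "0 \<le> l2_norm_vec x"
  by (simp add: l2_norm_vec_def scalar_prod_self_sum sum_nonneg)

lemma l2_norm_vec_square: "(l2_norm_vec x)\<^sup>2 = x \<bullet> x"
  by (simp add: l2_norm_vec_def scalar_prod_self_sum sum_nonneg)

lemma scalar_prod_le_l2_norm_vec:
  assumes "x \<in> carrier_vec n" "y \<in> carrier_vec n"
  shows "x \<bullet> y \<le> l2_norm_vec x * l2_norm_vec y"
proof -
  have "x \<bullet> y = (\<Sum>i<n. x $ i * y $ i)"
    using assms by (simp add: scalar_prod_def atLeast0LessThan)
  then have "(x \<bullet> y)\<^sup>2 \<le> (x \<bullet> x) * (y \<bullet> y)"
    using Cauchy_Schwarz_ineq_sum[of "\<lambda>i. x $ i" "\<lambda>i. y $ i" "{..<n}"] assms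
    by (simp add: scalar_prod_self_sum)
  then have "(x \<bullet> y)\<^sup>2 \<le> (l2_norm_vec x * l2_norm_vec y)\<^sup>2"
    by (simp add: power_mult_distrib l2_norm_vec_square)
  then show ?thesis
    by (rule power2_le_imp_le) (simp add: l2_norm_vec_nonneg)
qed

lemma l2_norm_vec_isometry:
  assumes "V \<in> carrier_mat m k" "transpose_mat V * V = 1\<^sub>m k" "z \<in> carrier_vec k"
  shows "l2_norm_vec (V *\<^sub>v z) = l2_norm_vec z"
proof -
  have "(V *\<^sub>v z) \<bullet> (V *\<^sub>v z) = (transpose_mat V *\<^sub>v (V *\<^sub>v z)) \<bullet> z"
    using assms by (subst transpose_vec_mult_scalar[of _ m k]) auto
  also have "transpose_mat V *\<^sub>v (V *\<^sub>v z) = z"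
    using assms by (subst assoc_mult_mat_vec[of _ k m _ k, symmetric]) auto
  finally show ?thesis
    by (simp add: l2_norm_vec_def)
qed

lemma spectral_norm_le:
  assumes "A \<in> carrier_mat r c" "0 \<le> C"
    and bound: "\<And>x. x \<in> carrier_vec c \<Longrightarrow> l2_norm_vec (A *\<^sub>v x) \<le> C * l2_norm_vec x"
  shows "spectral_norm A \<le> C"
  unfolding spectral_norm_def
proof (rule cSup_least)
  have "0\<^sub>v c \<in> carrier_vec (dim_col A) \<and> l2_norm_vec (0\<^sub>v c) \<le> 1"
    using assms by (auto simp: l2_norm_vec_def)
  then show "{l2_norm_vec (A *\<^sub>v x) |x. x \<in> carrier_vec (dim_col A) \<and> l2_norm_vec x \<le> 1} \<noteq> {}"
    by blast
next
  fix t
  assume "t \<in> {l2_norm_vec (A *\<^sub>v x) |x. x \<in> carrier_vec (dim_col A) \<and> l2_norm_vec x \<le> 1}"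
  then obtain x where x: "t = l2_norm_vec (A *\<^sub>v x)" "x \<in> carrier_vec c" "l2_norm_vec x \<le> 1"
    using assms(1) by auto
  have "t \<le> C * l2_norm_vec x"
    using bound x by simp
  also have "\<dots> \<le> C"
    using mult_left_mono[OF x(3) assms(2)] by simp
  finally show "t \<le> C" .
qed

text \<open>
  Apply the bound for \<open>A\<close> in
  \<open>\<parallel>A\<^sup>T y\<parallel>\<^sup>2 = y \<bullet> A (A\<^sup>T y) \<le> \<parallel>y\<parallel> \<parallel>A (A\<^sup>T y)\<parallel>\<close> and cancel \<open>\<parallel>A\<^sup>T y\<parallel>\<close>.
\<close>

lemma l2_bound_transpose:
  assumes A: "A \<in> carrier_mat r c" and "0 \<le> C"
    and bound: "\<And>x. x \<in> carrier_vec c \<Longrightarrow> l2_norm_vec (A *\<^sub>v x) \<le> C * l2_norm_vec x"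
    and y: "y \<in> carrier_vec r"
  shows "l2_norm_vec (transpose_mat A *\<^sub>v y) \<le> C * l2_norm_vec y"
proof -
  let ?z = "transpose_mat A *\<^sub>v y"
  have z: "?z \<in> carrier_vec c"
    using A y by auto
  have "(l2_norm_vec ?z)\<^sup>2 = y \<bullet> (A *\<^sub>v ?z)"
    unfolding l2_norm_vec_square using transpose_vec_mult_scalar[OF A z y] by simp
  also have "\<dots> \<le> l2_norm_vec y * l2_norm_vec (A *\<^sub>v ?z)"
    using A y by (intro scalar_prod_le_l2_norm_vec[of _ r]) auto
  also have "\<dots> \<le> l2_norm_vec y * (C * l2_norm_vec ?z)"
    by (intro mult_left_mono bound z l2_norm_vec_nonneg)
  finally have *: "l2_norm_vec ?z * l2_norm_vec ?z \<le> (C * l2_norm_vec y) * l2_norm_vec ?z"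
    by (simp add: power2_eq_square mult_ac)
  show ?thesis
  proof (cases "l2_norm_vec ?z = 0")
    case True
    then show ?thesis
      using \<open>0 \<le> C\<close> l2_norm_vec_nonneg[of y] by simp
  next
    case False
    then show ?thesis
      using * l2_norm_vec_nonneg[of ?z] by (simp add: mult_le_cancel_right)
  qed
qed

section \<open>Inverses and selected rows\<close>

lemma mat_inv_of_det:
  assumes A: "A \<in> carrier_mat n n" and "det A \<noteq> 0"
  shows "mat_inv A \<in> carrier_mat n n" "A * mat_inv A = 1\<^sub>m n" "mat_inv A * A = 1\<^sub>m n"
proof -
  have "mat_inverse A \<noteq> None"
    using mat_inverse(1)[OF A, of "()"] det_non_zero_imp_unit[OF assms, of "()"] by blast
  then obtain B where B: "mat_inverse A = Some B"
    by auto
  then show "mat_inv A \<in> carrier_mat n n" "A * mat_inv A = 1\<^sub>m n" "mat_inv A * A = 1\<^sub>m n"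
    using mat_inverse(2)[OF A B] by (auto simp: mat_inv_def)
qed

lemma invertible_mat_of_det:
  assumes A: "A \<in> carrier_mat n n" and "det A \<noteq> (0 :: real)"
  shows "invertible_mat A"
proof -
  note inv = mat_inv_of_det[OF assms]
  have "inverts_mat A (mat_inv A)" "inverts_mat (mat_inv A) A"
    using A inv by (auto simp: inverts_mat_def)
  then show ?thesis
    using A by (auto simp: invertible_mat_def)
qed

lemma selection_mat_carrier: "selection_mat m p \<in> carrier_mat m (length p)"
  using mat_of_cols_carrier(1)[of m "map (unit_vec m) p"] by (simp add: selection_mat_def)

lemma selected_rows_carrier:
  "B \<in> carrier_mat m k \<Longrightarrow> transpose_mat (selection_mat m p) * B \<in> carrier_mat (length p) k"
  by (auto simp: selection_mat_def)

lemma selected_rows_mult_vec: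
  assumes "x \<in> carrier_vec m" "l < length p" "p ! l < m"
  shows "(transpose_mat (selection_mat m p) *\<^sub>v x) $ l = x $ (p ! l)"
proof -
  have "col (selection_mat m p) l = unit_vec m (p ! l)"
    using assms by (simp add: selection_mat_def)
  then show ?thesis
    using assms by (simp add: selection_mat_def)
qed

lemma selected_rows_assoc:
  assumes "B \<in> carrier_mat m k" "z \<in> carrier_vec k"
  shows "(transpose_mat (selection_mat m p) * B) *\<^sub>v z
    = transpose_mat (selection_mat m p) *\<^sub>v (B *\<^sub>v z)"
  using assms
  by (intro assoc_mult_mat_vec[of _ "length p" m _ k]) (auto simp: selection_mat_def)

lemma first_cols_carrier:
  assumes "V \<in> carrier_mat m k" "j \<le> k"
  shows "first_cols V j \<in> carrier_mat m j"
  using assms by (auto simp: first_cols_def)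

lemma first_cols_index:
  assumes "V \<in> carrier_mat m k" "j \<le> k" "i < m" "l < j"
  shows "first_cols V j $$ (i, l) = V $$ (i, l)"
  using assms by (auto simp: first_cols_def mat_of_cols_index)

lemma first_cols_mult_vec:
  assumes "V \<in> carrier_mat m k" "j \<le> k" "i < m" "z \<in> carrier_vec j"
  shows "(first_cols V j *\<^sub>v z) $ i = (\<Sum>l<j. z $ l * V $$ (i, l))"
  using assms first_cols_carrier[OF assms(1,2)] first_cols_index[OF assms(1,2)]
  by (auto simp: scalar_prod_def atLeast0LessThan mult.commute intro!: sum.cong)

lemma first_cols_all: "V \<in> carrier_mat m k \<Longrightarrow> first_cols V k = V"
  by (rule eq_matI) (auto simp: first_cols_index first_cols_def mat_of_cols_index)

lemma first_cols_orthonormal: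
  assumes U: "U \<in> carrier_mat m m" "transpose_mat U * U = 1\<^sub>m m" and "k \<le> m"
  shows "transpose_mat (first_cols U k) * first_cols U k = 1\<^sub>m k"
proof (rule eq_matI)
  fix i j
  assume ij: "i < dim_row (1\<^sub>m k)" "j < dim_col (1\<^sub>m k)"
  have c: "col (first_cols U k) l = col U l" if "l < k" for l
  proof -
    have "take k (cols U) ! l = col U l" "col U l \<in> carrier_vec (dim_row U)"
      using that assms by auto
    then show ?thesis
      using that assms by (simp add: first_cols_def)
  qed
  have "col U i \<bullet> col U j = (transpose_mat U * U) $$ (i, j)"
    using ij U(1) \<open>k \<le> m\<close> by simp
  also have "\<dots> = (if i = j then 1 else 0)"
    unfolding U(2) using ij \<open>k \<le> m\<close> by simp
  finally have "col U i \<bullet> col U j = (if i = j then 1 else 0)" .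
  then show "(transpose_mat (first_cols U k) * first_cols U k) $$ (i, j) = 1\<^sub>m k $$ (i, j)"
    using ij assms first_cols_carrier[OF U(1) \<open>k \<le> m\<close>] c by simp
qed (use first_cols_carrier[OF U(1) \<open>k \<le> m\<close>] in auto)

section \<open>Greedy interpolation\<close>

text \<open>
  The functions \<open>v 0, \<dots>, v (j - 1)\<close> span the current space, \<open>r\<close> is the residual of the next
  function \<open>v j\<close>, and \<open>p j\<close> is a point where \<open>\<bar>r\<bar>\<close> is maximal. Rewriting \<open>v j\<close> through \<open>r\<close> splits
  \<open>u = (\<Sum>l<Suc j. c l * v l)\<close> into \<open>w + c j * r\<close>, where \<open>w\<close> has the same values as \<open>u\<close> at the old
  points. Each weight doubles because the bound for \<open>w\<close> enters both directly and through
  \<open>c j * r (p j) = u (p j) - w (p j)\<close>.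
\<close>

lemma greedy_step:
  fixes v :: "nat \<Rightarrow> 'a \<Rightarrow> real" and p :: "nat \<Rightarrow> 'a"
  assumes bound: "\<And>c x. x \<in> X \<Longrightarrow> \<bar>\<Sum>l<j. c l * v l x\<bar>
      \<le> (\<Sum>i<j. 2 ^ (j - Suc i) * \<bar>\<Sum>l<j. c l * v l (p i)\<bar>)"
    and r: "\<And>x. x \<in> X \<Longrightarrow> r x = v j x - (\<Sum>l<j. z l * v l x)"
    and r0: "\<And>i. i < j \<Longrightarrow> r (p i) = 0"
    and rmax: "\<And>x. x \<in> X \<Longrightarrow> \<bar>r x\<bar> \<le> \<bar>r (p j)\<bar>"
    and p: "\<And>i. i \<le> j \<Longrightarrow> p i \<in> X"
    and x: "x \<in> X"
  shows "\<bar>\<Sum>l<Suc j. c l * v l x\<bar>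
    \<le> (\<Sum>i<Suc j. 2 ^ (Suc j - Suc i) * \<bar>\<Sum>l<Suc j. c l * v l (p i)\<bar>)"
proof -
  define u where "u y = (\<Sum>l<Suc j. c l * v l y)" for y
  define w where "w y = (\<Sum>l<j. (c l + c j * z l) * v l y)" for y
  have split: "u y = w y + c j * r y" if "y \<in> X" for y
    by (simp add: u_def w_def r[OF that] algebra_simps sum.distrib sum_distrib_left)
  define S where "S = (\<Sum>i<j. 2 ^ (j - Suc i) * \<bar>u (p i)\<bar>)"
  have "w (p i) = u (p i)" if "i < j" for i
    using split[of "p i"] p that r0 by simp
  then have w: "\<bar>w y\<bar> \<le> S" if "y \<in> X" for y
    using bound[OF that, of "\<lambda>l. c l + c j * z l"] by (simp add: S_def flip: w_def)
  have "\<bar>c j * r x\<bar> \<le> \<bar>c j * r (p j)\<bar>"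
    using rmax[OF x] by (simp add: abs_mult mult_left_mono)
  also have "c j * r (p j) = u (p j) - w (p j)"
    using split[of "p j"] p by simp
  also have "\<bar>\<dots>\<bar> \<le> \<bar>u (p j)\<bar> + S"
    using w[of "p j"] p by fastforce
  finally have "\<bar>u x\<bar> \<le> 2 * S + \<bar>u (p j)\<bar>"
    using split[OF x] w[OF x] by linarith
  also have "2 * S = (\<Sum>i<j. 2 ^ (Suc j - Suc i) * \<bar>u (p i)\<bar>)"
    unfolding S_def sum_distrib_left
    by (rule sum.cong) (auto simp: Suc_diff_Suc simp flip: power_Suc)
  finally show ?thesis
    unfolding u_def[symmetric] by simp
qed

lemma abs_index_le_linf_norm_vec: "i < dim_vec x \<Longrightarrow> \<bar>x $ i\<bar> \<le> linf_norm_vec x"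
  unfolding linf_norm_vec_def by (rule Max_ge) auto

text \<open>
  Multiplying the residual by \<open>P\<^sup>T\<close> cancels the interpolation matrix against its inverse, which
  leaves \<open>P\<^sup>T v - P\<^sup>T v = 0\<close>. The residual is expanded into coefficients \<open>z\<close> so that the first
  stage, which subtracts nothing, needs no separate treatment afterwards.
\<close>

lemma DEIM_residual_interpolates:
  assumes V: "V \<in> carrier_mat m k" and j: "j < k"
    and p: "j \<le> length p" "\<And>l. l < j \<Longrightarrow> p ! l < m"
    and det: "det (transpose_mat (selection_mat m (take j p)) * first_cols V j) \<noteq> 0"
  obtains z where "\<And>i. i < m \<Longrightarrow> deim_residual V p j $ i = V $$ (i, j) - (\<Sum>l<j. z l * V $$ (i, l))"
    and "\<And>l. l < j \<Longrightarrow> deim_residual V p j $ (p ! l) = 0"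
    and "dim_vec (deim_residual V p j) = m"
proof (cases "j = 0")
  case True
  then show ?thesis
    using that[of "\<lambda>_. 0"] V j by (simp add: deim_residual_def)
next
  case False
  define T where "T = transpose_mat (selection_mat m (take j p))"
  define F where "F = first_cols V j"
  define z where "z = mat_inv (T * F) *\<^sub>v (T *\<^sub>v col V j)"
  have F: "F \<in> carrier_mat m j"
    unfolding F_def using V j by (intro first_cols_carrier) auto
  have TF: "T * F \<in> carrier_mat j j"
    using selected_rows_carrier[OF F, of "take j p"] p by (simp add: T_def min_absorb2)
  have T: "T \<in> carrier_mat j m"
    using p selection_mat_carrier[of m "take j p"] by (simp add: T_def min_absorb2)
  note inv = mat_inv_of_det[OF TF]
  have det': "det (T * F) \<noteq> 0"
    using det by (simp add: T_def F_def)
  have v: "col V j \<in> carrier_vec m"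
    using V by auto
  have z: "z \<in> carrier_vec j"
    unfolding z_def using inv(1)[OF det'] T v by auto
  have res: "deim_residual V p j = col V j - F *\<^sub>v z"
    using False V by (simp add: deim_residual_def Let_def z_def T_def F_def)
  have "T *\<^sub>v (F *\<^sub>v z) = (T * F) *\<^sub>v z"
    using T F z by simp
  also have "\<dots> = (T * F * mat_inv (T * F)) *\<^sub>v (T *\<^sub>v col V j)"
    unfolding z_def using TF T v inv(1)[OF det'] by (intro assoc_mult_mat_vec[symmetric]) auto
  also have "\<dots> = T *\<^sub>v col V j"
    using inv(2)[OF det'] T v by simp
  finally have eq: "T *\<^sub>v (F *\<^sub>v z) = T *\<^sub>v col V j" .
  show ?thesis
  proof (rule that)
    show "dim_vec (deim_residual V p j) = m"
      using res F by simp
    show "deim_residual V p j $ i = V $$ (i, j) - (\<Sum>l<j. z $ l * V $$ (i, l))" if "i < m" for i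
      using first_cols_mult_vec[OF V _ that z] that F V j by (simp add: res F_def del: index_mult_mat_vec)
    show "deim_residual V p j $ (p ! l) = 0" if l: "l < j" for l
    proof -
      have sel: "(T *\<^sub>v x) $ l = x $ (p ! l)" if "x \<in> carrier_vec m" for x
        using selected_rows_mult_vec[OF that, of l "take j p"] p l by (simp add: T_def)
      have "(F *\<^sub>v z) $ (p ! l) = col V j $ (p ! l)"
        using sel[OF v] sel[of "F *\<^sub>v z"] eq F z by simp
      then show ?thesis
        using p(2)[OF l] F V by (simp add: res del: index_mult_mat_vec)
    qed
  qed
qed

text \<open>
  The bound at stage \<open>j\<close> implies that stage \<open>j\<close> is nonsingular: if all selected entries of
  an element of the span vanish, so does the element, and its coefficients vanish by independence.
\<close>

lemma selected_rows_nonsingular: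
  assumes V: "V \<in> carrier_mat m k" and j: "j \<le> k"
    and indep: "\<And>c. (\<And>i. i < m \<Longrightarrow> (\<Sum>l<k. c l * V $$ (i, l)) = 0) \<Longrightarrow> \<forall>l<k. c l = 0"
    and p: "j \<le> length p" "\<And>l. l < j \<Longrightarrow> p ! l < m"
    and bound: "\<And>c i. i < m \<Longrightarrow> \<bar>\<Sum>l<j. c l * V $$ (i, l)\<bar>
      \<le> (\<Sum>l<j. 2 ^ (j - Suc l) * \<bar>\<Sum>l'<j. c l' * V $$ (p ! l, l')\<bar>)"
  shows "det (transpose_mat (selection_mat m (take j p)) * first_cols V j) \<noteq> 0"
proof
  let ?T = "transpose_mat (selection_mat m (take j p))"
  let ?F = "first_cols V j"
  have F: "?F \<in> carrier_mat m j"
    using V j by (rule first_cols_carrier)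
  have TF: "?T * ?F \<in> carrier_mat j j"
    using selected_rows_carrier[OF F, of "take j p"] p by (simp add: min_absorb2)
  assume "det (?T * ?F) = 0"
  then obtain z where z: "z \<in> carrier_vec j" "z \<noteq> 0\<^sub>v j" "(?T * ?F) *\<^sub>v z = 0\<^sub>v j"
    using det_0_iff_vec_prod_zero_field[OF TF] by auto
  have sel: "(\<Sum>l'<j. z $ l' * V $$ (p ! l, l')) = 0" if l: "l < j" for l
  proof -
    have "0 = (?T *\<^sub>v (?F *\<^sub>v z)) $ l"
      using z l by (simp add: selected_rows_assoc[OF F z(1), symmetric] del: index_mult_mat_vec)
    also have "\<dots> = (?F *\<^sub>v z) $ (p ! l)"
      using selected_rows_mult_vec[of "?F *\<^sub>v z" m l "take j p"] F z p l
      by (simp del: index_mult_mat_vec)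
    also have "\<dots> = (\<Sum>l'<j. z $ l' * V $$ (p ! l, l'))"
      using first_cols_mult_vec[OF V j p(2)[OF l] z(1)] .
    finally show ?thesis by simp
  qed
  have *: "(\<Sum>l<j. z $ l * V $$ (i, l)) = 0" if "i < m" for i
    using bound[OF that, of "\<lambda>l. z $ l"] by (simp add: sel)
  have "(\<Sum>l<k. (if l < j then z $ l else 0) * V $$ (i, l)) = 0" if "i < m" for i
  proof -
    have "(\<Sum>l<k. (if l < j then z $ l else 0) * V $$ (i, l)) = (\<Sum>l<j. z $ l * V $$ (i, l))"
      using j by (intro sum.mono_neutral_cong_right) auto
    then show ?thesis
      using *[OF that] by simp
  qed
  then have "\<forall>l<k. (if l < j then z $ l else 0) = 0"
    by (rule indep)
  then have "z = 0\<^sub>v j"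
    using z(1) j by (intro eq_vecI) (auto split: if_splits)
  then show False
    using z(2) by simp
qed

text \<open>
  The induction hypothesis is used twice: it makes the interpolation matrix of stage \<open>j\<close>
  nonsingular, so that the residual vanishes at the old indices, and it is the bound that
  \<open>greedy_step\<close> extends.
\<close>

lemma DEIM_entry_bound:
  assumes V: "V \<in> carrier_mat m k"
    and indep: "\<And>c. (\<And>i. i < m \<Longrightarrow> (\<Sum>l<k. c l * V $$ (i, l)) = 0) \<Longrightarrow> \<forall>l<k. c l = 0"
    and D: "is_DEIM V p"
  shows "j \<le> k \<Longrightarrow> i < m \<Longrightarrow> \<bar>\<Sum>l<j. c l * V $$ (i, l)\<bar>
    \<le> (\<Sum>l<j. 2 ^ (j - Suc l) * \<bar>\<Sum>l'<j. c l' * V $$ (p ! l, l')\<bar>)"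
proof (induction j arbitrary: c i)
  case 0
  then show ?case by simp
next
  case (Suc j)
  have len: "length p = k" and pm: "\<And>l. l < k \<Longrightarrow> p ! l < m"
    and pmax: "\<bar>deim_residual V p j $ (p ! j)\<bar> = linf_norm_vec (deim_residual V p j)"
    using D V Suc.prems by (auto simp: is_DEIM_def)
  have "det (transpose_mat (selection_mat m (take j p)) * first_cols V j) \<noteq> 0"
    using V _ indep
  proof (rule selected_rows_nonsingular)
    show "\<bar>\<Sum>l<j. c l * V $$ (i, l)\<bar>
      \<le> (\<Sum>l<j. 2 ^ (j - Suc l) * \<bar>\<Sum>l'<j. c l' * V $$ (p ! l, l')\<bar>)" if "i < m" for c i
      using Suc.IH Suc.prems that by simp
  qed (use Suc.prems len pm in auto)
  then obtain z where
    z: "\<And>i. i < m \<Longrightarrow> deim_residual V p j $ i = V $$ (i, j) - (\<Sum>l<j. z l * V $$ (i, l))"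
      "\<And>l. l < j \<Longrightarrow> deim_residual V p j $ (p ! l) = 0"
      "dim_vec (deim_residual V p j) = m"
    using DEIM_residual_interpolates[OF V, of j p] Suc.prems len pm by auto
  show ?case
  proof (rule greedy_step[where X = "{..<m}" and r = "\<lambda>i. deim_residual V p j $ i" and z = z
        and v = "\<lambda>l i. V $$ (i, l)" and p = "\<lambda>l. p ! l"])
    show "\<bar>deim_residual V p j $ i\<bar> \<le> \<bar>deim_residual V p j $ (p ! j)\<bar>" if "i \<in> {..<m}" for i
      using that abs_index_le_linf_norm_vec z(3) by (simp add: pmax)
    show "\<bar>\<Sum>l<j. c l * V $$ (i, l)\<bar>
      \<le> (\<Sum>l<j. 2 ^ (j - Suc l) * \<bar>\<Sum>l'<j. c l' * V $$ (p ! l, l')\<bar>)" if "i \<in> {..<m}" for c i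
      using Suc.IH Suc.prems that by simp
  qed (use z pm Suc.prems in auto)
qed

section \<open>The error constants\<close>

text \<open>
  For \<open>z = (P\<^sup>T V)\<^sup>-\<^sup>1 x\<close> the vector \<open>V z\<close> has the same norm as \<open>z\<close>, and its selected entries are
  those of \<open>x\<close>. So every one of its \<open>m\<close> entries is at most \<open>(\<Sum>l<k. 2^(k-1-l) \<bar>x(l)\<bar>)\<close> in modulus;
  the Cauchy-Schwarz inequality bounds the square of this by \<open>(4^k - 1)/3 \<parallel>x\<parallel>\<^sup>2\<close>.
\<close>

lemma DEIM_orthonormal_inverse_bound:
  assumes V: "V \<in> carrier_mat m k" and orth: "transpose_mat V * V = 1\<^sub>m k"
    and D: "is_DEIM V p"
  shows "transpose_mat (selection_mat m p) * V \<in> carrier_mat k k"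
    and "det (transpose_mat (selection_mat m p) * V) \<noteq> 0"
    and "x \<in> carrier_vec k \<Longrightarrow> l2_norm_vec (mat_inv (transpose_mat (selection_mat m p) * V) *\<^sub>v x)
      \<le> sqrt (real m * (4 ^ k - 1) / 3) * l2_norm_vec x"
proof -
  let ?T = "transpose_mat (selection_mat m p)"
  have len: "length p = k" and pm: "\<And>l. l < k \<Longrightarrow> p ! l < m"
    using D V by (auto simp: is_DEIM_def)
  have mult: "(V *\<^sub>v z) $ i = (\<Sum>l<k. z $ l * V $$ (i, l))" if "i < m" "z \<in> carrier_vec k" for i z
    using first_cols_mult_vec[OF V order_refl that] by (simp only: first_cols_all[OF V])
  have indep: "\<forall>l<k. c l = 0" if c: "\<And>i. i < m \<Longrightarrow> (\<Sum>l<k. c l * V $$ (i, l)) = 0" for c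
  proof -
    have "V *\<^sub>v vec k c = 0\<^sub>v m"
      using V mult[of _ "vec k c"] c by (intro eq_vecI) (auto simp del: index_mult_mat_vec)
    then have "vec k c \<bullet> vec k c = 0"
      using l2_norm_vec_isometry[OF V orth, of "vec k c"] by (simp add: l2_norm_vec_def)
    then show ?thesis
      by (auto simp: scalar_prod_self_sum sum_nonneg_eq_0_iff)
  qed
  have entry: "\<bar>\<Sum>l<k. c l * V $$ (i, l)\<bar>
      \<le> (\<Sum>l<k. 2 ^ (k - Suc l) * \<bar>\<Sum>l'<k. c l' * V $$ (p ! l, l')\<bar>)" if "i < m" for c i
    using V indep D order_refl that by (rule DEIM_entry_bound)
  show TV: "?T * V \<in> carrier_mat k k"
    using selected_rows_carrier[OF V] len by metis
  have "det (transpose_mat (selection_mat m (take k p)) * first_cols V k) \<noteq> 0"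
    using V order_refl indep
    by (rule selected_rows_nonsingular) (use entry len pm in auto)
  then show det: "det (?T * V) \<noteq> 0"
    by (simp add: len first_cols_all[OF V])
  note inv = mat_inv_of_det[OF TV det]
  show "l2_norm_vec (mat_inv (?T * V) *\<^sub>v x) \<le> sqrt (real m * (4 ^ k - 1) / 3) * l2_norm_vec x"
    if x: "x \<in> carrier_vec k"
  proof -
    define z where "z = mat_inv (?T * V) *\<^sub>v x"
    have z: "z \<in> carrier_vec k"
      using inv x by (auto simp: z_def)
    have "(?T * V) *\<^sub>v z = (?T * V * mat_inv (?T * V)) *\<^sub>v x"
      unfolding z_def using TV inv x by (intro assoc_mult_mat_vec[symmetric]) auto
    then have Tx: "?T *\<^sub>v (V *\<^sub>v z) = x"
      using inv x selected_rows_assoc[OF V z, of p] by simp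
    have sel: "(\<Sum>l'<k. z $ l' * V $$ (p ! l, l')) = x $ l" if "l < k" for l
      using selected_rows_mult_vec[of "V *\<^sub>v z" m l p] mult[OF pm[OF that] z] that len pm V z Tx
      by (simp del: index_mult_mat_vec)
    have geom: "(\<Sum>l<k. (2 ^ (k - Suc l))\<^sup>2) = (4 ^ k - 1) / (3 :: real)"
    proof -
      have "(\<Sum>l<k. (2 ^ (k - Suc l))\<^sup>2) = (\<Sum>l<k. (4 :: real) ^ (k - Suc l))"
        by (simp add: power2_eq_square flip: power_mult_distrib)
      also have "\<dots> = (\<Sum>l<k. 4 ^ l)"
        by (rule sum.nat_diff_reindex)
      finally show ?thesis
        by (simp add: geometric_sum)
    qed
    have sq: "((V *\<^sub>v z) $ i)\<^sup>2 \<le> (4 ^ k - 1) / 3 * (x \<bullet> x)" if i: "i < m" for i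
    proof -
      have "\<bar>(V *\<^sub>v z) $ i\<bar> \<le> (\<Sum>l<k. 2 ^ (k - Suc l) * \<bar>x $ l\<bar>)"
        using entry[OF i, of "\<lambda>l. z $ l"] sel mult[OF i z] by (simp del: index_mult_mat_vec)
      then have "((V *\<^sub>v z) $ i)\<^sup>2 \<le> (\<Sum>l<k. 2 ^ (k - Suc l) * \<bar>x $ l\<bar>)\<^sup>2"
        by (metis abs_ge_zero power2_abs power_mono)
      also have "\<dots> \<le> (\<Sum>l<k. (2 ^ (k - Suc l))\<^sup>2) * (\<Sum>l<k. \<bar>x $ l\<bar>\<^sup>2)"
        by (rule Cauchy_Schwarz_ineq_sum)
      also have "\<dots> = (4 ^ k - 1) / 3 * (x \<bullet> x)"
        using x by (subst geom) (simp add: scalar_prod_self_sum)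
      finally show ?thesis .
    qed
    have "(l2_norm_vec z)\<^sup>2 = (\<Sum>i<m. ((V *\<^sub>v z) $ i)\<^sup>2)"
      using V by (subst l2_norm_vec_isometry[OF V orth z, symmetric])
        (simp add: l2_norm_vec_square scalar_prod_self_sum)
    also have "\<dots> \<le> (\<Sum>i<m. (4 ^ k - 1) / 3 * (x \<bullet> x))"
      by (intro sum_mono sq) auto
    also have "\<dots> = real m * (4 ^ k - 1) / 3 * (l2_norm_vec x)\<^sup>2"
      by (simp add: l2_norm_vec_square)
    finally have "l2_norm_vec z \<le> sqrt (real m * (4 ^ k - 1) / 3 * (l2_norm_vec x)\<^sup>2)"
      by (rule real_le_rsqrt)
    then show ?thesis
      unfolding z_def real_sqrt_mult[of _ "(l2_norm_vec x)\<^sup>2"]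
      by (simp add: l2_norm_vec_nonneg)
  qed
qed

lemma DEIM_constant_less:
  assumes "1 \<le> k" "k \<le> m"
  shows "sqrt (real m * (4 ^ k - 1) / 3) < sqrt (real m * real k / 3) * 2 ^ k"
proof -
  have "real m * (4 ^ k - 1) < real m * (1 * 4 ^ k)"
    using assms by simp
  also have "\<dots> \<le> real m * (real k * 4 ^ k)"
    using assms by (intro mult_left_mono mult_right_mono) auto
  finally have "sqrt (real m * (4 ^ k - 1) / 3) < sqrt (real m * real k / 3 * 4 ^ k)"
    by simp
  also have "\<dots> = sqrt (real m * real k / 3) * sqrt (4 ^ k)"
    by (rule real_sqrt_mult)
  also have "sqrt (4 ^ k) = 2 ^ k"
    by (simp add: real_sqrt_power)
  finally show ?thesis .
qed

lemma DEIM_orthonormal_spectral_norm: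
  assumes V: "V \<in> carrier_mat m k" "transpose_mat V * V = 1\<^sub>m k" and "is_DEIM V p"
    and k: "1 \<le> k" "k \<le> m"
  defines "P \<equiv> selection_mat m p"
  shows "invertible_mat (transpose_mat P * V)" "invertible_mat (transpose_mat V * P)"
    "spectral_norm (mat_inv (transpose_mat P * V)) < sqrt (real m * real k / 3) * 2 ^ k"
    "spectral_norm (mat_inv (transpose_mat V * P)) < sqrt (real m * real k / 3) * 2 ^ k"
proof -
  let ?B = "transpose_mat P * V"
  let ?C = "sqrt (real m * (4 ^ k - 1) / 3)"
  note bound = DEIM_orthonormal_inverse_bound[OF assms(1-3), folded P_def]
  note inv = mat_inv_of_det[OF bound(1,2)]
  have C: "0 \<le> ?C"
    by simp
  have P: "P \<in> carrier_mat m (length p)"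
    unfolding P_def by (rule selection_mat_carrier)
  have Bt: "transpose_mat V * P = transpose_mat ?B"
    using transpose_mult[of "transpose_mat P" "length p" m V k] P V by simp
  have Bt_carrier: "transpose_mat ?B \<in> carrier_mat k k"
    using bound(1) by simp
  have det: "det (transpose_mat ?B) \<noteq> 0"
    using bound(1,2) by (simp add: det_transpose)
  note invt = mat_inv_of_det[OF Bt_carrier det]
  show "invertible_mat ?B" "invertible_mat (transpose_mat V * P)"
    using invertible_mat_of_det bound(1,2) Bt_carrier det Bt by metis+
  have "spectral_norm (mat_inv ?B) \<le> ?C"
    using inv(1) C bound(3) by (rule spectral_norm_le)
  then show "spectral_norm (mat_inv ?B) < sqrt (real m * real k / 3) * 2 ^ k"
    using DEIM_constant_less[OF k] by linarith
  \<comment> \<open>Inversion commutes with transposition because a left inverse of \<open>?B\<^sup>T\<close> equals its inverse.\<close>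
  have left: "transpose_mat (mat_inv ?B) * transpose_mat ?B = 1\<^sub>m k"
    using transpose_mult[OF bound(1) inv(1)] inv(2) by simp
  have "transpose_mat (mat_inv ?B)
      = transpose_mat (mat_inv ?B) * (transpose_mat ?B * mat_inv (transpose_mat ?B))"
    using inv(1) invt(2) by simp
  also have "\<dots> = (transpose_mat (mat_inv ?B) * transpose_mat ?B) * mat_inv (transpose_mat ?B)"
    using inv(1) invt(1) Bt_carrier by (intro assoc_mult_mat[symmetric]) auto
  also have "\<dots> = mat_inv (transpose_mat ?B)"
    using left invt(1) by simp
  finally have inv_t: "mat_inv (transpose_mat ?B) = transpose_mat (mat_inv ?B)"
    by simp
  have "spectral_norm (mat_inv (transpose_mat ?B)) \<le> ?C"
    using invt(1) C
  proof (rule spectral_norm_le)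
    show "l2_norm_vec (mat_inv (transpose_mat ?B) *\<^sub>v y) \<le> ?C * l2_norm_vec y"
      if "y \<in> carrier_vec k" for y
      unfolding inv_t using inv(1) C bound(3) that by (rule l2_bound_transpose)
  qed
  then show "spectral_norm (mat_inv (transpose_mat V * P)) < sqrt (real m * real k / 3) * 2 ^ k"
    unfolding Bt using DEIM_constant_less[OF k] by linarith
qed

theorem lemma4p4:
  fixes A V W P Q :: "real mat" and m n k :: nat and p q :: "nat list"
    and \<eta>\<^sub>p \<eta>\<^sub>q :: real
  assumes "A \<in> carrier_mat m n" and "1 \<le> k" and "k \<le> min m n"
    and "leading_singular_vectors A k V W"
    and "is_DEIM V p" and "is_DEIM W q"
    and "P = selection_mat m p" and "Q = selection_mat n q"
    and "\<eta>\<^sub>p = spectral_norm (mat_inv (transpose_mat P * V))"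
    and "\<eta>\<^sub>q = spectral_norm (mat_inv (transpose_mat W * Q))"
  shows "invertible_mat (transpose_mat P * V) \<and> invertible_mat (transpose_mat W * Q) \<and>
    \<eta>\<^sub>p < sqrt (real m * real k / 3) * 2 ^ k \<and>
    \<eta>\<^sub>q < sqrt (real n * real k / 3) * 2 ^ k"
proof -
  obtain U S Y where svd: "is_svd A U S Y" and VW: "V = first_cols U k" "W = first_cols Y k"
    using assms(4) by (auto simp: leading_singular_vectors_def)
  have U: "U \<in> carrier_mat m m" "transpose_mat U * U = 1\<^sub>m m"
    and Y: "Y \<in> carrier_mat n n" "transpose_mat Y * Y = 1\<^sub>m n"
    using svd assms(1) by (auto simp: is_svd_def Let_def)
  have k: "k \<le> m" "k \<le> n"
    using assms(3) by auto
  have V: "V \<in> carrier_mat m k" "transpose_mat V * V = 1\<^sub>m k"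
    and W: "W \<in> carrier_mat n k" "transpose_mat W * W = 1\<^sub>m k"
    unfolding VW using first_cols_carrier first_cols_orthonormal U Y k by auto
  show ?thesis
    using DEIM_orthonormal_spectral_norm[OF V assms(5,2) k(1)]
      DEIM_orthonormal_spectral_norm[OF W assms(6,2) k(2)]
    unfolding assms(7-10) by blast
qed

end
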